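(* Let $c_0,c_h\in\mathbb{R}$ be constants and let $(T,\mathbf{J},\boldsymbol{\psi},\varphi)$ be a smooth solution on $\Omega\times[0,t_f]$ of $$\partial_t T+c_0\nabla\cdot\mathbf{J}=0,\qquad \partial_t\mathbf{J}+c_0\nabla T+c_h\nabla\times\boldsymbol{\psi}=-\tfrac1\tau\mathbf{J},$$ $$\partial_t\boldsymbol{\psi}-c_h\nabla\times\mathbf{J}+c_h\nabla\varphi=0,\qquad \partial_t\varphi+c_h\nabla\cdot\boldsymbol{\psi}=0,$$ with boundary conditions such that the boundary terms vanish, i.e. $\int_{\partial\Omega}(c_0T\mathbf{J}+c_h\boldsymbol{\psi}\times\mathbf{J}+c_h\varphi\boldsymbol{\psi})\cdot\mathbf{n}\,\mathrm{d}S=0$ for all $t$. Then the total energy $$\mathrm{E}(t)=\int_\Omega\tfrac12\big(T^2+\|\mathbf{J}\|^2+\|\boldsymbol{\psi}\|^2+\varphi^2\big)(\mathbf{x},t)\,\mathrm{d}\Omega$$ satisfies, for all $t\in[0,t_f]$, $$\mathrm{E}(t)-\mathrm{E}(0)=-\frac1\tau\int_0^t\int_\Omega\|\mathbf{J}(\mathbf{x},s)\|^2\,\mathrm{d}\Omega\,\mathrm{d}s\le0.$$ In particular: (a) for finite $\tau>0$, the energy is non-increasing; (b) in the absence of relaxation ($1/\tau=0$), the total energy is conserved. Consequently, the solution is uniformly bounded in $L^\infty(0,t_f;L^2(\Omega))$.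
   Context: $\Omega\subset\mathbb{R}^3$ is a bounded domain on which the divergence theorem holds, with unit outward normal $\mathbf{n}$; $t_f>0$. The unknowns are $T,\varphi\in\mathbb{R}$ and $\mathbf{J},\boldsymbol{\psi}\in\mathbb{R}^3$, functions of $(\mathbf{x},t)$. The relaxation time is a constant $\tau\in(0,+\infty]$, with the convention that $1/\tau=0$ (i.e. $\tau=+\infty$) means the relaxation source term is absent. $\|\cdot\|$ is the Euclidean norm. The uniform bound is in terms of the initial energy $\mathrm{E}(0)$. *)

theory Defs
  imports "HOL-Analysis.Analysis" "HOL-Probability.Essential_Supremum"
begin

section \<open>Smooth functions\<close>

primrec Ck_open :: "nat \<Rightarrow> 'a::real_normed_vector set \<Rightarrow> ('a \<Rightarrow> 'b::real_normed_vector) \<Rightarrow> bool" where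
  "Ck_open 0 U f \<longleftrightarrow> continuous_on U f"
| "Ck_open (Suc k) U f \<longleftrightarrow>
     (\<forall>x\<in>U. f differentiable (at x)) \<and> (\<forall>v. Ck_open k U (\<lambda>x. frechet_derivative f (at x) v))"

text \<open>On a set that need not be open, \<open>C\<^sup>k\<close> and \<open>C\<^sup>\<infinity>\<close> mean: the restriction of a
  \<open>C\<^sup>k\<close> (\<open>C\<^sup>\<infinity>\<close>) function defined on some open neighbourhood of the set.\<close>

definition Ck_on :: "nat \<Rightarrow> 'a::real_normed_vector set \<Rightarrow> ('a \<Rightarrow> 'b::real_normed_vector) \<Rightarrow> bool" where
  "Ck_on k S f \<longleftrightarrow> (\<exists>U g. open U \<and> S \<subseteq> U \<and> Ck_open k U g \<and> (\<forall>x\<in>S. g x = f x))"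

definition smooth_on :: "'a::real_normed_vector set \<Rightarrow> ('a \<Rightarrow> 'b::real_normed_vector) \<Rightarrow> bool" where
  "smooth_on S f \<longleftrightarrow> (\<exists>U g. open U \<and> S \<subseteq> U \<and> (\<forall>k. Ck_open k U g) \<and> (\<forall>x\<in>S. g x = f x))"

section \<open>Vector calculus in three dimensions\<close>

definition partial_deriv :: "3 \<Rightarrow> (real^3 \<Rightarrow> real) \<Rightarrow> real^3 \<Rightarrow> real" where
  "partial_deriv i f x = deriv (\<lambda>h. f (x + h *\<^sub>R axis i 1)) 0"

definition gradient :: "(real^3 \<Rightarrow> real) \<Rightarrow> real^3 \<Rightarrow> real^3" where
  "gradient f x = (\<chi> i. partial_deriv i f x)"

definition divergence :: "(real^3 \<Rightarrow> real^3) \<Rightarrow> real^3 \<Rightarrow> real" where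
  "divergence F x = (\<Sum>i\<in>UNIV. partial_deriv i (\<lambda>y. F y $ i) x)"

definition curl :: "(real^3 \<Rightarrow> real^3) \<Rightarrow> real^3 \<Rightarrow> real^3" where
  "curl F x = vector
     [partial_deriv 2 (\<lambda>y. F y $ 3) x - partial_deriv 3 (\<lambda>y. F y $ 2) x,
      partial_deriv 3 (\<lambda>y. F y $ 1) x - partial_deriv 1 (\<lambda>y. F y $ 3) x,
      partial_deriv 1 (\<lambda>y. F y $ 2) x - partial_deriv 2 (\<lambda>y. F y $ 1) x]"

section \<open>Surface measure\<close>

text \<open>The surface measure \<open>dS\<close> is the two-dimensional Hausdorff measure. The factor \<open>pi / 4\<close>
  (the area of a disc of diameter 1) makes it agree with the usual area of surfaces.\<close>

definition diam_covers :: "real \<Rightarrow> 'a::metric_space set \<Rightarrow> (nat \<Rightarrow> 'a set) set" where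
  "diam_covers \<delta> A = {C. A \<subseteq> (\<Union>i. C i) \<and> (\<forall>i. bounded (C i) \<and> diameter (C i) \<le> \<delta>)}"

definition hausdorff2_pre :: "real \<Rightarrow> 'a::metric_space set \<Rightarrow> ennreal" where
  "hausdorff2_pre \<delta> A = (INF C\<in>diam_covers \<delta> A. \<Sum>i. ennreal (pi / 4 * (diameter (C i))\<^sup>2))"

definition hausdorff2_outer :: "'a::metric_space set \<Rightarrow> ennreal" where
  "hausdorff2_outer A = (SUP \<delta>\<in>{0<..}. hausdorff2_pre \<delta> A)"

definition hausdorff2 :: "'a::metric_space measure" where
  "hausdorff2 = measure_of UNIV (sets borel) hausdorff2_outer"

lemma space_hausdorff2 [simp]: "space hausdorff2 = UNIV"
  by (simp add: hausdorff2_def)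

lemma sets_hausdorff2 [simp, measurable_cong]: "sets hausdorff2 = sets borel"
  unfolding hausdorff2_def using sets.sigma_sets_eq[of borel] by (simp add: space_borel)

text \<open>The constant \<open>measure_of\<close> yields the zero measure unless its argument is countably additive,
  so we verify (Caratheodory's criterion) that \<open>hausdorff2\<close> really extends
  \<open>hausdorff2_outer\<close>.\<close>

lemma hausdorff2_pre_mono: "A \<subseteq> B \<Longrightarrow> hausdorff2_pre \<delta> A \<le> hausdorff2_pre \<delta> B"
  unfolding hausdorff2_pre_def by (rule INF_superset_mono) (auto simp: diam_covers_def)

lemma hausdorff2_pre_antimono: "\<delta> \<le> \<epsilon> \<Longrightarrow> hausdorff2_pre \<epsilon> A \<le> hausdorff2_pre \<delta> A"
  unfolding hausdorff2_pre_def
  by (rule INF_superset_mono) (auto simp: diam_covers_def intro: order_trans)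

lemma hausdorff2_pre_empty: "0 < \<delta> \<Longrightarrow> hausdorff2_pre \<delta> {} = 0"
  unfolding hausdorff2_pre_def
  by (rule antisym, rule INF_lower2[where i="\<lambda>_. {}"]) (auto simp: diam_covers_def)

lemma hausdorff2_pre_UN:
  fixes A :: "nat \<Rightarrow> 'a::metric_space set"
  shows "hausdorff2_pre \<delta> (\<Union>i. A i) \<le> (\<Sum>i. hausdorff2_pre \<delta> (A i))"
proof (cases "\<exists>i. hausdorff2_pre \<delta> (A i) = top")
  case True
  then obtain i where "hausdorff2_pre \<delta> (A i) = top" by blast
  moreover have "(\<Sum>i\<in>{i}. hausdorff2_pre \<delta> (A i)) \<le> (\<Sum>i. hausdorff2_pre \<delta> (A i))"
    by (intro sum_le_suminf) auto
  ultimately show ?thesis by (simp add: top_unique)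
next
  case False
  show ?thesis
  proof (rule ennreal_le_epsilon)
    fix e :: real assume e: "0 < e"
    have "\<exists>C\<in>diam_covers \<delta> (A i). (\<Sum>j. ennreal (pi / 4 * (diameter (C j))\<^sup>2))
            < hausdorff2_pre \<delta> (A i) + ennreal (e * (1/2) ^ Suc i)" for i
      using False e by (intro INF_approx_ennreal[OF _ hausdorff2_pre_def]) auto
    then obtain C where C: "\<And>i. C i \<in> diam_covers \<delta> (A i)"
      "\<And>i. (\<Sum>j. ennreal (pi / 4 * (diameter (C i j))\<^sup>2))
            < hausdorff2_pre \<delta> (A i) + ennreal (e * (1/2) ^ Suc i)"
      by metis
    define D where "D k = (case prod_decode k of (i, j) \<Rightarrow> C i j)" for k
    have "D \<in> diam_covers \<delta> (\<Union>i. A i)"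
    proof -
      have "x \<in> (\<Union>k. D k)" if x: "x \<in> A i" for x i
      proof -
        obtain j where "x \<in> C i j" using C(1)[of i] x by (auto simp: diam_covers_def)
        then have "x \<in> D (prod_encode (i, j))" by (simp add: D_def)
        then show ?thesis by blast
      qed
      then show ?thesis using C(1) by (auto simp: diam_covers_def D_def split: prod.split)
    qed
    then have "hausdorff2_pre \<delta> (\<Union>i. A i) \<le> (\<Sum>k. ennreal (pi / 4 * (diameter (D k))\<^sup>2))"
      unfolding hausdorff2_pre_def by (rule INF_lower)
    also have "\<dots> = (\<Sum>i. \<Sum>j. ennreal (pi / 4 * (diameter (C i j))\<^sup>2))"
      unfolding D_def
      by (rule suminf_ennreal_2dimen[where
            f="\<lambda>p. ennreal (pi / 4 * (diameter (case p of (i, j) \<Rightarrow> C i j))\<^sup>2)"])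
         (simp only: prod.case)
    also have "\<dots> \<le> (\<Sum>i. hausdorff2_pre \<delta> (A i) + ennreal (e * (1/2) ^ Suc i))"
      by (intro suminf_le less_imp_le C(2)) auto
    also have "\<dots> = (\<Sum>i. hausdorff2_pre \<delta> (A i)) + (\<Sum>i. ennreal (e * (1/2) ^ Suc i))"
      by (rule suminf_add[symmetric]) auto
    also have "(\<Sum>i. ennreal (e * (1/2) ^ Suc i)) = ennreal e"
      using sums_mult[OF power_half_series, of e] e by (intro suminf_ennreal_eq) auto
    finally show "hausdorff2_pre \<delta> (\<Union>i. A i) \<le> (\<Sum>i. hausdorff2_pre \<delta> (A i)) + ennreal e" .
  qed
qed

lemma hausdorff2_pre_separated:
  assumes "\<delta> < e" and sep: "\<And>x y. x \<in> A \<Longrightarrow> y \<in> B \<Longrightarrow> e \<le> dist x y"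
  shows "hausdorff2_pre \<delta> A + hausdorff2_pre \<delta> B \<le> hausdorff2_pre \<delta> (A \<union> B)"
  unfolding hausdorff2_pre_def[of \<delta> "A \<union> B"]
proof (rule INF_greatest)
  fix C assume C: "C \<in> diam_covers \<delta> (A \<union> B)"
  let ?w = "\<lambda>S::'a set. ennreal (pi / 4 * (diameter S)\<^sup>2)"
  define P where "P S i = (if C i \<inter> S = {} then {} else C i)" for S :: "'a set" and i
  have \<delta>: "0 \<le> \<delta>" 
  proof -
    have "0 \<le> diameter (C 0)" "diameter (C 0) \<le> \<delta>"
      using C by (auto simp: diam_covers_def intro: diameter_ge_0)
    then show ?thesis by (rule order_trans)
  qed
  have "P S \<in> diam_covers \<delta> S" if "S \<subseteq> A \<union> B" for S
  proof -
    have "x \<in> (\<Union>i. P S i)" if "x \<in> S" for x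
    proof -
      have "x \<in> (\<Union>i. C i)" using C \<open>x \<in> S\<close> \<open>S \<subseteq> A \<union> B\<close>
        unfolding diam_covers_def by blast
      then obtain i where "x \<in> C i" by blast
      then have "x \<in> P S i" using \<open>x \<in> S\<close> by (auto simp: P_def)
      then show ?thesis by blast
    qed
    moreover have "bounded (P S i) \<and> diameter (P S i) \<le> \<delta>" for i
      using C \<delta> by (simp add: diam_covers_def P_def)
    ultimately show ?thesis by (auto simp: diam_covers_def)
  qed
  then have "hausdorff2_pre \<delta> A + hausdorff2_pre \<delta> B \<le> (\<Sum>i. ?w (P A i)) + (\<Sum>i. ?w (P B i))"
    unfolding hausdorff2_pre_def by (intro add_mono INF_lower) auto
  also have "\<dots> = (\<Sum>i. ?w (P A i) + ?w (P B i))" by (rule suminf_add) auto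
  also have "\<dots> \<le> (\<Sum>i. ?w (C i))"
  proof (rule suminf_le)
    fix i
    have "C i \<inter> A = {} \<or> C i \<inter> B = {}"
    proof (rule ccontr)
      assume "\<not> ?thesis"
      then obtain x y where xy: "x \<in> C i" "x \<in> A" "y \<in> C i" "y \<in> B" by blast
      have "dist x y \<le> diameter (C i)"
        using C xy by (intro diameter_bounded_bound) (auto simp: diam_covers_def)
      moreover have "diameter (C i) \<le> \<delta>" using C by (auto simp: diam_covers_def)
      ultimately show False using sep[OF xy(2,4)] assms(1) by linarith
    qed
    then show "?w (P A i) + ?w (P B i) \<le> ?w (C i)" by (auto simp: P_def)
  qed auto
  finally show "hausdorff2_pre \<delta> A + hausdorff2_pre \<delta> B \<le> (\<Sum>i. ?w (C i))" .
qed

lemma hausdorff2_outer_mono: "A \<subseteq> B \<Longrightarrow> hausdorff2_outer A \<le> hausdorff2_outer B"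
  unfolding hausdorff2_outer_def by (intro SUP_mono) (auto intro: hausdorff2_pre_mono)

lemma hausdorff2_outer_empty: "hausdorff2_outer {} = 0"
  unfolding hausdorff2_outer_def by (simp add: hausdorff2_pre_empty)

lemma hausdorff2_outer_UN: "hausdorff2_outer (\<Union>i::nat. A i) \<le> (\<Sum>i. hausdorff2_outer (A i))"
  unfolding hausdorff2_outer_def[of "\<Union>i. A i"]
proof (rule SUP_least)
  fix \<delta> :: real assume "\<delta> \<in> {0<..}"
  then have "(\<Sum>i. hausdorff2_pre \<delta> (A i)) \<le> (\<Sum>i. hausdorff2_outer (A i))"
    unfolding hausdorff2_outer_def by (intro suminf_le SUP_upper) auto
  then show "hausdorff2_pre \<delta> (\<Union>i. A i) \<le> (\<Sum>i. hausdorff2_outer (A i))"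
    using hausdorff2_pre_UN order_trans by blast
qed

lemma hausdorff2_outer_Un: "hausdorff2_outer (A \<union> B) \<le> hausdorff2_outer A + hausdorff2_outer B"
proof -
  have "hausdorff2_outer (\<Union>i. binaryset A B i) \<le> (\<Sum>i. hausdorff2_outer (binaryset A B i))"
    by (rule hausdorff2_outer_UN)
  also have "\<dots> = hausdorff2_outer A + hausdorff2_outer B"
    by (rule suminf_binaryset_eq) (simp add: hausdorff2_outer_empty)
  finally show ?thesis by (simp add: UN_binaryset_eq)
qed

lemma hausdorff2_outer_separated:
  assumes e: "0 < e" and sep: "\<And>x y. x \<in> A \<Longrightarrow> y \<in> B \<Longrightarrow> e \<le> dist x y"
  shows "hausdorff2_outer A + hausdorff2_outer B \<le> hausdorff2_outer (A \<union> B)"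
proof -
  have *: "hausdorff2_pre \<delta> A + hausdorff2_pre \<eta> B \<le> hausdorff2_outer (A \<union> B)"
    if "0 < \<delta>" "0 < \<eta>" for \<delta> \<eta>
  proof -
    define \<theta> where "\<theta> = min (min \<delta> \<eta>) (e / 2)"
    have \<theta>: "0 < \<theta>" "\<theta> \<le> \<delta>" "\<theta> \<le> \<eta>" "\<theta> < e" using that e by (auto simp: \<theta>_def)
    have "hausdorff2_pre \<delta> A + hausdorff2_pre \<eta> B \<le> hausdorff2_pre \<theta> A + hausdorff2_pre \<theta> B"
      by (intro add_mono hausdorff2_pre_antimono \<theta>)
    also have "\<dots> \<le> hausdorff2_pre \<theta> (A \<union> B)" by (rule hausdorff2_pre_separated[OF \<theta>(4) sep])
    also have "\<dots> \<le> hausdorff2_outer (A \<union> B)"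
      unfolding hausdorff2_outer_def using \<theta>(1) by (intro SUP_upper) auto
    finally show ?thesis .
  qed
  have **: "hausdorff2_outer A + hausdorff2_pre \<eta> B \<le> hausdorff2_outer (A \<union> B)" if "0 < \<eta>" for \<eta>
    unfolding hausdorff2_outer_def[of A]
    by (subst ennreal_SUP_add_left[symmetric]) (auto intro!: SUP_least * that)
  show ?thesis
    unfolding hausdorff2_outer_def[of B]
    by (subst add.commute, subst ennreal_SUP_add_left[symmetric])
       (auto intro!: SUP_least ** simp: add.commute[of _ "hausdorff2_outer A"])
qed

lemma hausdorff2_outer_closed_split:
  fixes A K :: "'a::metric_space set"
  assumes K: "closed K"
  shows "hausdorff2_outer (A \<inter> K) + hausdorff2_outer (A - K) \<le> hausdorff2_outer A"
proof (cases "K = {} \<or> hausdorff2_outer A = top")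
  case True then show ?thesis by (auto simp: hausdorff2_outer_empty)
next
  case False
  then have ne: "K \<noteq> {}" and fin: "hausdorff2_outer A < top" by (auto simp: less_top)
  let ?H = "hausdorff2_outer :: 'a set \<Rightarrow> ennreal"
  define S where "S n = {x \<in> A. 1 / real (Suc n) \<le> infdist x K}" for n
  define D where "D n = S (Suc n) - S n" for n
  have S_mono: "S m \<subseteq> S n" if "m \<le> n" for m n
  proof -
    have "1 / real (Suc n) \<le> 1 / real (Suc m)" using that by (intro frac_le) auto
    then show ?thesis unfolding S_def by (auto intro: order_trans)
  qed
  have near: "infdist x K \<le> infdist y K + dist x y" for x y by (rule infdist_triangle)
  have part: "?H (A \<inter> K) + ?H (S n) \<le> ?H A" for n
  proof -
    have "?H (A \<inter> K) + ?H (S n) \<le> ?H (A \<inter> K \<union> S n)"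
    proof (rule hausdorff2_outer_separated)
      fix x y assume x: "x \<in> A \<inter> K" and y: "y \<in> S n"
      have "infdist y K \<le> dist y x" using x by (intro infdist_le) auto
      then show "1 / real (Suc n) \<le> dist x y" using y by (auto simp: S_def dist_commute)
    qed simp
    also have "\<dots> \<le> ?H A" by (rule hausdorff2_outer_mono) (auto simp: S_def)
    finally show ?thesis .
  qed
  have parity: "(\<Sum>k<m. ?H (D (2 * k + j))) \<le> ?H (\<Union>k<m. D (2 * k + j))" for m j
  proof (induction m)
    case (Suc m)
    have "(\<Sum>k<Suc m. ?H (D (2 * k + j))) \<le> ?H (\<Union>k<m. D (2 * k + j)) + ?H (D (2 * m + j))"
      using Suc by (simp add: add_right_mono)
    also have "\<dots> \<le> ?H ((\<Union>k<m. D (2 * k + j)) \<union> D (2 * m + j))"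
    proof (cases "m = 0")
      case True then show ?thesis by (simp add: hausdorff2_outer_empty)
    next
      case False
      let ?p = "2 * m + j"
      show ?thesis
      proof (rule hausdorff2_outer_separated[where e="1 / real ?p - 1 / real (Suc ?p)"])
        show "0 < 1 / real ?p - 1 / real (Suc ?p)" using False by (simp add: divide_strict_left_mono)
        fix x y assume "x \<in> (\<Union>k<m. D (2 * k + j))" and y: "y \<in> D ?p"
        then obtain k where k: "k < m" "x \<in> D (2 * k + j)" by auto
        have "D (2 * k + j) \<subseteq> S (?p - 1)"
        proof -
          have "Suc (2 * k + j) \<le> ?p - 1" using k(1) by linarith
          then show ?thesis unfolding D_def using S_mono[of "Suc (2 * k + j)" "?p - 1"] by blast
        qed
        then have "1 / real ?p \<le> infdist x K" using k(2) False by (auto simp: S_def)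
        moreover have "infdist y K < 1 / real (Suc ?p)" using y by (auto simp: D_def S_def)
        ultimately show "1 / real ?p - 1 / real (Suc ?p) \<le> dist x y" using near[of x y] by linarith
      qed
    qed
    also have "\<dots> = ?H (\<Union>k<Suc m. D (2 * k + j))" by (simp add: lessThan_Suc Un_commute)
    finally show ?case .
  qed simp
  have DA: "D n \<subseteq> A" for n by (auto simp: D_def S_def)
  have bound: "(\<Sum>k<m. ?H (D k)) \<le> 2 * ?H A" for m
  proof -
    have "(\<Sum>k<m. ?H (D k)) \<le> (\<Sum>k<2*m. ?H (D k))" by (rule sum_mono2) auto
    also have "\<dots> = (\<Sum>k<m. ?H (D (2 * k + 0))) + (\<Sum>k<m. ?H (D (2 * k + 1)))"
      by (induction m) (auto simp: algebra_simps)
    also have "\<dots> \<le> ?H (\<Union>k<m. D (2 * k + 0)) + ?H (\<Union>k<m. D (2 * k + 1))"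
      by (intro add_mono parity)
    also have "\<dots> \<le> ?H A + ?H A"
      using DA by (intro add_mono hausdorff2_outer_mono) auto
    finally show ?thesis by (simp add: mult_2)
  qed
  have tot: "(\<Sum>k. ?H (D k)) < top"
    using suminf_le_const[OF _ bound] fin
    by (auto simp: ennreal_mult_less_top intro: order_le_less_trans)
  have Hfin: "?H (D k) \<noteq> top" for k
    using hausdorff2_outer_mono[OF DA[of k]] fin by (auto simp: top_unique)
  have tail: "(\<lambda>n. \<Sum>k. ?H (D (k + n))) \<longlonglongrightarrow> 0"
  proof -
    define r where "r k = enn2real (?H (D k))" for k
    have r: "?H (D k) = ennreal (r k)" "0 \<le> r k" for k using Hfin by (auto simp: r_def less_top)
    have sm: "summable r"
      using tot by (intro summable_suminf_not_top r(2)) (simp add: r(1))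
    have "(\<lambda>n. \<Sum>k. r (k + n)) \<longlonglongrightarrow> 0"
    proof -
      have "(\<lambda>n. (\<Sum>k. r k) - (\<Sum>k<n. r k)) \<longlonglongrightarrow> (\<Sum>k. r k) - (\<Sum>k. r k)"
        by (intro tendsto_intros summable_LIMSEQ sm)
      then show ?thesis by (simp add: suminf_minus_initial_segment[OF sm])
    qed
    then have "(\<lambda>n. ennreal (\<Sum>k. r (k + n))) \<longlonglongrightarrow> ennreal 0" by (rule tendsto_ennrealI)
    moreover have "(\<Sum>k. ?H (D (k + n))) = ennreal (\<Sum>k. r (k + n))" for n
      unfolding r using sm by (intro suminf_ennreal2 r) (simp add: summable_iff_shift)
    ultimately show ?thesis by simp
  qed
  have cover: "A - K \<subseteq> S n \<union> (\<Union>k. D (k + n))" for n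
  proof
    fix x assume x: "x \<in> A - K"
    then have "0 < infdist x K" using K ne by (simp add: infdist_pos_not_in_closed)
    then obtain q where "1 / real (Suc q) < infdist x K" using nat_approx_posE by metis
    then have ex: "x \<in> S q" using x by (auto simp: S_def)
    show "x \<in> S n \<union> (\<Union>k. D (k + n))"
    proof (cases "x \<in> S n")
      case False
      define p where "p = (LEAST p. x \<in> S p)"
      have p: "x \<in> S p" unfolding p_def by (rule LeastI[of _ q]) (rule ex)
      have "n < p" using p False S_mono[of p n] by (meson not_le subsetD)
      moreover have "x \<notin> S (p - 1)"
        using not_less_Least[of "p - 1" "\<lambda>p. x \<in> S p"] \<open>n < p\<close> by (auto simp: p_def)
      ultimately have "x \<in> D ((p - 1 - n) + n)" using p by (auto simp: D_def)
      then show ?thesis by blast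
    qed simp
  qed
  have "?H (A \<inter> K) + ?H (A - K) \<le> ?H A + (\<Sum>k. ?H (D (k + n)))" for n
  proof -
    have "?H (A - K) \<le> ?H (S n) + (\<Sum>k. ?H (D (k + n)))"
      by (rule order_trans[OF hausdorff2_outer_mono[OF cover[of n]]
            order_trans[OF hausdorff2_outer_Un add_left_mono[OF hausdorff2_outer_UN]]])
    then have "?H (A \<inter> K) + ?H (A - K) \<le> (?H (A \<inter> K) + ?H (S n)) + (\<Sum>k. ?H (D (k + n)))"
      by (simp add: add.assoc add_left_mono)
    also have "\<dots> \<le> ?H A + (\<Sum>k. ?H (D (k + n)))" by (intro add_right_mono part)
    finally show ?thesis .
  qed
  moreover have "(\<lambda>n. ?H A + (\<Sum>k. ?H (D (k + n)))) \<longlonglongrightarrow> ?H A + 0"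
    by (intro tendsto_add tendsto_const tail)
  ultimately have "?H (A \<inter> K) + ?H (A - K) \<le> ?H A + 0"
    by (intro LIMSEQ_le_const) auto
  then show ?thesis by simp
qed

theorem emeasure_hausdorff2:
  fixes A :: "'a::metric_space set"
  assumes "A \<in> sets borel"
  shows "emeasure hausdorff2 A = hausdorff2_outer A"
proof -
  let ?L = "lambda_system UNIV UNIV (hausdorff2_outer :: 'a set \<Rightarrow> ennreal)"
  have om: "outer_measure_space UNIV (hausdorff2_outer :: 'a set \<Rightarrow> ennreal)"
    by (auto simp: outer_measure_space_def positive_def increasing_def countably_subadditive_def
        hausdorff2_outer_empty intro: hausdorff2_outer_mono hausdorff2_outer_UN)
  interpret U: sigma_algebra UNIV "UNIV :: 'a set set"
    using sigma_algebra_Pow[of "UNIV :: 'a set"] by simp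
  have ms: "measure_space UNIV ?L hausdorff2_outer" by (rule U.caratheodory_lemma[OF om])
  have "K \<in> ?L" if "closed K" for K :: "'a set"
    unfolding U.lambda_system_eq
    using hausdorff2_outer_closed_split[OF that]
      hausdorff2_outer_Un[where A="x \<inter> K" and B="x - K" for x]
    by (auto simp: Un_Diff_Int Int_Diff_Un intro!: antisym)
  then have "sigma_sets UNIV (Collect closed) \<subseteq> ?L"
    using ms by (intro sigma_algebra.sigma_sets_subset) (auto simp: measure_space_def)
  then have sub: "sets borel \<subseteq> ?L" by (simp add: borel_eq_closed)
  have "measure_space UNIV (sets borel) (hausdorff2_outer :: 'a set \<Rightarrow> ennreal)"
    using ms sub sets.sigma_algebra_axioms[of borel]
    by (intro measure_down[OF ms]) (auto simp: space_borel)
  then have "countably_additive (sets borel) (hausdorff2_outer :: 'a set \<Rightarrow> ennreal)"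
    by (simp add: measure_space_def)
  then show ?thesis
    using assms sets.sigma_sets_eq[of "borel :: 'a measure"]
    by (intro emeasure_measure_of[OF hausdorff2_def])
       (auto simp: positive_def hausdorff2_outer_empty sets_hausdorff2)
qed

section \<open>Outward unit normal and divergence theorem\<close>

text \<open>The exterior unit normal in the sense of Federer: near \<open>x\<close>, \<open>\<Omega>\<close> fills the half-space
  \<open>{y. (y - x) \<bullet> \<nu> < 0}\<close> up to sets of density zero. It is unique when it exists, and
  coincides with the classical outward normal at points where the boundary is \<open>C\<^sup>1\<close>.\<close>

definition is_outward_unit_normal :: "(real^3) set \<Rightarrow> real^3 \<Rightarrow> real^3 \<Rightarrow> bool" where
  "is_outward_unit_normal \<Omega> x \<nu> \<longleftrightarrow> norm \<nu> = 1 \<and>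
     ((\<lambda>r. measure lborel {y \<in> \<Omega> \<inter> ball x r. (y - x) \<bullet> \<nu> > 0} / r ^ 3) \<longlongrightarrow> 0) (at_right 0) \<and>
     ((\<lambda>r. measure lborel {y \<in> ball x r - \<Omega>. (y - x) \<bullet> \<nu> < 0} / r ^ 3) \<longlongrightarrow> 0) (at_right 0)"

text \<open>Edges and corners are allowed, so the normal is only required to exist almost everywhere.\<close>

definition outward_unit_normal_field :: "(real^3) set \<Rightarrow> (real^3 \<Rightarrow> real^3) \<Rightarrow> bool" where
  "outward_unit_normal_field \<Omega> n \<longleftrightarrow>
     (AE x in hausdorff2. x \<in> frontier \<Omega> \<longrightarrow> is_outward_unit_normal \<Omega> x (n x))"

definition flux :: "(real^3) set \<Rightarrow> (real^3 \<Rightarrow> real^3) \<Rightarrow> (real^3 \<Rightarrow> real^3) \<Rightarrow> real" where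
  "flux \<Omega> n F = (LINT x:frontier \<Omega>|hausdorff2. F x \<bullet> n x)"

definition divergence_theorem_holds :: "(real^3) set \<Rightarrow> (real^3 \<Rightarrow> real^3) \<Rightarrow> bool" where
  "divergence_theorem_holds \<Omega> n \<longleftrightarrow>
     (\<forall>F. Ck_on 1 (closure \<Omega>) F \<longrightarrow>
        set_integrable hausdorff2 (frontier \<Omega>) (\<lambda>x. F x \<bullet> n x) \<and>
        (LINT x:\<Omega>|lborel. divergence F x) = flux \<Omega> n F)"

section \<open>Energy and the space \<open>L\<^sup>\<infinity>(0,t\<^sub>f; L\<^sup>2(\<Omega>))\<close>\<close>

definition energy ::
  "(real^3) set \<Rightarrow> (real^3 \<Rightarrow> real \<Rightarrow> real) \<Rightarrow> (real^3 \<Rightarrow> real \<Rightarrow> real^3) \<Rightarrow>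
   (real^3 \<Rightarrow> real \<Rightarrow> real^3) \<Rightarrow> (real^3 \<Rightarrow> real \<Rightarrow> real) \<Rightarrow> real \<Rightarrow> real" where
  "energy \<Omega> T J \<psi> \<phi> t =
     (LINT x:\<Omega>|lborel. 1/2 * ((T x t)\<^sup>2 + (norm (J x t))\<^sup>2 + (norm (\<psi> x t))\<^sup>2 + (\<phi> x t)\<^sup>2))"

definition L2_norm ::
  "'a::euclidean_space set \<Rightarrow> ('a \<Rightarrow> 'b::{real_normed_vector, second_countable_topology}) \<Rightarrow> ereal" where
  "L2_norm \<Omega> f =
     (if set_borel_measurable lborel \<Omega> f \<and> set_integrable lborel \<Omega> (\<lambda>x. (norm (f x))\<^sup>2)
      then ereal (sqrt (LINT x:\<Omega>|lborel. (norm (f x))\<^sup>2)) else \<infinity>)"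

definition Linf_L2_norm ::
  "real \<Rightarrow> 'a::euclidean_space set \<Rightarrow>
   ('a \<Rightarrow> real \<Rightarrow> 'b::{real_normed_vector, second_countable_topology}) \<Rightarrow> ereal" where
  "Linf_L2_norm tf \<Omega> u =
     esssup (restrict_space lborel {0<..<tf}) (\<lambda>t. L2_norm \<Omega> (\<lambda>x. u x t))"

text \<open>For separable \<open>L\<^sup>2(\<Omega>)\<close>, strong measurability of \<open>t \<mapsto> u(\<cdot>, t)\<close> is rendered as joint
  measurability of \<open>u\<close> on \<open>\<Omega> \<times> (0,t\<^sub>f)\<close>.\<close>

definition in_Linf_L2 ::
  "real \<Rightarrow> 'a::euclidean_space set \<Rightarrow>
   ('a \<Rightarrow> real \<Rightarrow> 'b::{real_normed_vector, second_countable_topology}) \<Rightarrow> bool" where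
  "in_Linf_L2 tf \<Omega> u \<longleftrightarrow>
     set_borel_measurable lborel (\<Omega> \<times> {0<..<tf}) (\<lambda>(x, t). u x t) \<and> Linf_L2_norm tf \<Omega> u < \<infinity>"

end

theory Submission
  imports Defs
begin

text \<open>The product rules for the divergence, in particular
  \<open>div (\<psi> \<times> J) = J \<bullet> curl \<psi> - \<psi> \<bullet> curl J\<close>, turn the equations into the local balance
  \<open>\<partial>\<^sub>t e + div F = - |J|\<^sup>2 / \<tau>\<close> for the energy density \<open>e\<close>, with flux
  \<open>F = c\<^sub>0 T J + c\<^sub>h \<psi> \<times> J + c\<^sub>h \<phi> \<psi>\<close>. Integrating over \<open>\<Omega> \<times> [a,b]\<close>, the flux drops out by the
  divergence theorem and the boundary condition. The square of the spatial \<open>L\<^sup>2\<close> norm of the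
  solution is twice the energy, so the uniform bound is monotonicity of the energy.\<close>

section \<open>Closure properties of continuously differentiable functions\<close>

text \<open>\<open>frechet_derivative\<close> is a choice, but derivatives at a point are unique, so
  any explicit derivative \<open>f'\<close> may be substituted for it on \<open>U\<close>.
  Continuity is asked separately for each direction \<open>v\<close>, as in
  \<open>Ck_open\<close>.\<close>

lemma Ck_open_1I:
  assumes "\<And>x. x \<in> U \<Longrightarrow> (f has_derivative f' x) (at x)"
    and "\<And>v. continuous_on U (\<lambda>x. f' x v)"
  shows "Ck_open 1 U f"
proof -
  have eq: "frechet_derivative f (at x) = f' x" if "x \<in> U" for x
    using frechet_derivative_at[OF assms(1)[OF that]] by simp
  have "continuous_on U (\<lambda>x. frechet_derivative f (at x) v)" for v
    using assms(2)[of v] by (rule continuous_on_eq) (simp add: eq)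
  then show ?thesis
    using assms(1) by (auto simp: differentiable_def)
qed

lemma
  assumes "Ck_open 1 U f"
  shows Ck_open_1_has_derivative:
      "x \<in> U \<Longrightarrow> (f has_derivative frechet_derivative f (at x)) (at x)"
    and Ck_open_1_continuous_frechet_derivative:
      "continuous_on U (\<lambda>x. frechet_derivative f (at x) v)"
    and Ck_open_1_continuous_on: "continuous_on U f"
  using assms
  by (auto simp: frechet_derivative_works[symmetric]
      intro!: continuous_at_imp_continuous_on differentiable_imp_continuous_within)

lemma Ck_open_1_subset:
  assumes "Ck_open 1 U f" and "V \<subseteq> U"
  shows "Ck_open 1 V f"
  using assms by (auto intro: continuous_on_subset)

lemma Ck_open_1_add:
  assumes "Ck_open 1 U f" and "Ck_open 1 U g"
  shows "Ck_open 1 U (\<lambda>x. f x + g x)"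
proof (rule Ck_open_1I)
  show "((\<lambda>x. f x + g x) has_derivative
      (\<lambda>v. frechet_derivative f (at x) v + frechet_derivative g (at x) v)) (at x)" if "x \<in> U" for x
    by (intro has_derivative_add Ck_open_1_has_derivative[OF _ that] assms)
  show "continuous_on U (\<lambda>x. frechet_derivative f (at x) v + frechet_derivative g (at x) v)" for v
    by (intro continuous_on_add Ck_open_1_continuous_frechet_derivative assms)
qed

text \<open>The Leibniz rule exhibits the derivative as a sum of products of continuous maps.
  Stating it for any bounded bilinear map serves both scalar multiples and the cross product in the
  energy flux.\<close>

lemma Ck_open_1_bounded_bilinear:
  assumes B: "bounded_bilinear B" and f: "Ck_open 1 U f" and g: "Ck_open 1 U g"
  shows "Ck_open 1 U (\<lambda>x. B (f x) (g x))"
proof (rule Ck_open_1I)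
  show "((\<lambda>x. B (f x) (g x)) has_derivative
      (\<lambda>v. B (f x) (frechet_derivative g (at x) v) + B (frechet_derivative f (at x) v) (g x))) (at x)"
    if "x \<in> U" for x
    by (intro bounded_bilinear.FDERIV[OF B] Ck_open_1_has_derivative[OF _ that] f g)
  show "continuous_on U
      (\<lambda>x. B (f x) (frechet_derivative g (at x) v) + B (frechet_derivative f (at x) v) (g x))" for v
    by (intro continuous_on_add bounded_bilinear.continuous_on[OF B]
        Ck_open_1_continuous_frechet_derivative Ck_open_1_continuous_on f g)
qed

lemma Ck_open_1_slice:
  assumes "Ck_open 1 U g"
  shows "Ck_open 1 ((\<lambda>x. (x, t)) -` U) (\<lambda>x. g (x, t))"
proof (rule Ck_open_1I)
  fix x assume "x \<in> (\<lambda>x. (x, t)) -` U"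
  then have "(g has_derivative frechet_derivative g (at (x, t))) (at (x, t))"
    by (intro Ck_open_1_has_derivative[OF assms]) simp
  moreover have "((\<lambda>x. (x, t)) has_derivative (\<lambda>v. (v, 0))) (at x)"
    by (auto intro!: derivative_eq_intros)
  ultimately show "((\<lambda>x. g (x, t)) has_derivative (\<lambda>v. frechet_derivative g (at (x, t)) (v, 0))) (at x)"
    by (auto dest: has_derivative_compose)
next
  show "continuous_on ((\<lambda>x. (x, t)) -` U) (\<lambda>x. frechet_derivative g (at (x, t)) (v, 0))" for v
    by (rule continuous_on_compose2[OF Ck_open_1_continuous_frechet_derivative[OF assms]])
       (auto intro!: continuous_intros)
qed

lemma Ck_on_1_add:
  assumes "Ck_on 1 S f" and "Ck_on 1 S g"
  shows "Ck_on 1 S (\<lambda>x. f x + g x)"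
proof -
  obtain U V F G where "open U" "S \<subseteq> U" "Ck_open 1 U F" "\<forall>x\<in>S. F x = f x"
    "open V" "S \<subseteq> V" "Ck_open 1 V G" "\<forall>x\<in>S. G x = g x"
    using assms unfolding Ck_on_def by metis
  then show ?thesis unfolding Ck_on_def
    by (intro exI[of _ "U \<inter> V"] exI[of _ "\<lambda>x. F x + G x"] conjI Ck_open_1_add)
       (auto intro: Ck_open_1_subset simp del: One_nat_def)
qed

lemma Ck_on_1_bounded_bilinear:
  assumes "bounded_bilinear B" and "Ck_on 1 S f" and "Ck_on 1 S g"
  shows "Ck_on 1 S (\<lambda>x. B (f x) (g x))"
proof -
  obtain U V F G where "open U" "S \<subseteq> U" "Ck_open 1 U F" "\<forall>x\<in>S. F x = f x"
    "open V" "S \<subseteq> V" "Ck_open 1 V G" "\<forall>x\<in>S. G x = g x"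
    using assms(2,3) unfolding Ck_on_def by metis
  then show ?thesis unfolding Ck_on_def
    by (intro exI[of _ "U \<inter> V"] exI[of _ "\<lambda>x. B (F x) (G x)"] conjI
          Ck_open_1_bounded_bilinear[OF assms(1)])
       (auto intro: Ck_open_1_subset simp del: One_nat_def)
qed

lemma Ck_on_1_const: "Ck_on 1 S (\<lambda>x. c)"
  unfolding Ck_on_def
  by (intro exI[of _ UNIV] exI[of _ "\<lambda>x. c"] conjI Ck_open_1I[where f' = "\<lambda>_ _. 0"]) auto

text \<open>The extension \<open>F\<close> agrees with \<open>f\<close> on \<open>S\<close> only. At
  an interior point this is agreement on a neighbourhood, so the derivative of \<open>F\<close> is
  one of \<open>f\<close>.\<close>

lemma Ck_on_1_differentiable:
  assumes "Ck_on 1 S f" and "x \<in> interior S"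
  shows "f differentiable (at x)"
proof -
  obtain U F where F: "S \<subseteq> U" "Ck_open 1 U F" "\<forall>x\<in>S. F x = f x"
    using assms(1) unfolding Ck_on_def by metis
  have "(F has_derivative frechet_derivative F (at x)) (at x)"
    using F assms(2) interior_subset by (blast intro: Ck_open_1_has_derivative)
  then have "(f has_derivative frechet_derivative F (at x)) (at x)"
    by (rule has_derivative_transform_within_open[OF _ open_interior assms(2)])
       (use F(3) interior_subset in blast)
  then show ?thesis by (rule differentiableI)
qed

lemma smooth_on_imp_continuous_on:
  assumes "smooth_on S f"
  shows "continuous_on S f"
proof -
  obtain U g where g: "S \<subseteq> U" "\<And>k. Ck_open k U g" "\<forall>x\<in>S. g x = f x"
    using assms unfolding smooth_on_def by metis
  have "continuous_on U g"
    using g(2)[of 0] by simp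
  then have "continuous_on S g"
    using g(1) by (rule continuous_on_subset)
  then show ?thesis
    by (rule continuous_on_eq) (use g(3) in auto)
qed

text \<open>If \<open>U\<close> is an open neighbourhood of \<open>S \<times> I\<close>, then the
  points \<open>x\<close> with \<open>(x, t) \<in> U\<close> form an open neighbourhood of
  \<open>S\<close>, and freezing the time in the extension gives an extension of the slice.\<close>

lemma smooth_on_slice:
  assumes "smooth_on (S \<times> I) (\<lambda>(x, t). u x t)" and "t \<in> I"
  shows "Ck_on 1 S (\<lambda>x. u x t)"
proof -
  obtain U g where g: "open U" "S \<times> I \<subseteq> U" "\<And>k. Ck_open k U g" "\<forall>p\<in>S\<times>I. g p = (\<lambda>(x, t). u x t) p"
    using assms(1) unfolding smooth_on_def by metis
  show ?thesis unfolding Ck_on_def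
  proof (intro exI conjI)
    show "open ((\<lambda>x. (x, t)) -` U)"
      using g(1) by (rule open_vimage) (auto intro!: continuous_intros)
    show "Ck_open 1 ((\<lambda>x. (x, t)) -` U) (\<lambda>x. g (x, t))"
      by (rule Ck_open_1_slice[OF g(3)])
  qed (use g assms(2) in auto)
qed

text \<open>The derivative of the extension in direction \<open>(0, 1)\<close> serves as
  \<open>u'\<close>; it is continuous even where \<open>S \<times> I\<close> has boundary points. As
  \<open>u\<close> and the extension agree only for times in \<open>I\<close>, the derivative is
  taken within \<open>I\<close>.\<close>

lemma smooth_on_time_derivative:
  assumes "smooth_on (S \<times> I) (\<lambda>(x, t). u x t)"
  obtains u' where "continuous_on (S \<times> I) u'"
    and "\<And>x t. x \<in> S \<Longrightarrow> t \<in> I \<Longrightarrow>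
           ((\<lambda>s. u x s) has_vector_derivative u' (x, t)) (at t within I)"
proof -
  obtain U g where g: "S \<times> I \<subseteq> U" "\<And>k. Ck_open k U g" "\<forall>p\<in>S\<times>I. g p = (\<lambda>(x, t). u x t) p"
    using assms unfolding smooth_on_def by metis
  have g1: "Ck_open 1 U g" by (rule g(2))
  show thesis
  proof
    show "continuous_on (S \<times> I) (\<lambda>p. frechet_derivative g (at p) (0, 1))"
      using Ck_open_1_continuous_frechet_derivative[OF g1] g(1) by (rule continuous_on_subset)
    fix x t assume x: "x \<in> S" and t: "t \<in> I"
    have "(g has_derivative frechet_derivative g (at (x, t))) (at (x, t))"
      using g(1) x t by (intro Ck_open_1_has_derivative[OF g1]) auto
    moreover have "((\<lambda>s. (x, s)) has_vector_derivative (0, 1)) (at t within I)"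
      by (auto intro!: derivative_eq_intros)
    ultimately have "((g \<circ> (\<lambda>s. (x, s))) has_vector_derivative frechet_derivative g (at (x, t)) (0, 1))
        (at t within I)"
      by (intro vector_derivative_diff_chain_within[where g' = "frechet_derivative g (at (x, t))"])
         (auto intro: has_derivative_at_withinI)
    then show "((\<lambda>s. u x s) has_vector_derivative frechet_derivative g (at (x, t)) (0, 1)) (at t within I)"
      by (rule has_vector_derivative_transform[rotated 2]) (use g(3) x t in auto)
  qed
qed

section \<open>Product rules for the divergence\<close>

text \<open>Chain rule along the line through \<open>x\<close> in direction \<open>axis i 1\<close>.
  It expresses all partial derivatives through one linear map, so that divergence and curl inherit
  product rules from the full derivative.\<close>

lemma partial_deriv_eq:
  assumes "(f has_derivative f') (at x)"
  shows "partial_deriv i f x = f' (axis i 1)"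
proof -
  have "((\<lambda>h. x + h *\<^sub>R axis i 1) has_derivative (\<lambda>h. h *\<^sub>R axis i 1)) (at 0)"
    by (auto intro!: derivative_eq_intros)
  then have "((\<lambda>h. f (x + h *\<^sub>R axis i 1)) has_derivative (\<lambda>h. f' (h *\<^sub>R axis i 1))) (at 0)"
    by (rule has_derivative_compose) (use assms in simp)
  moreover have "(\<lambda>h. f' (h *\<^sub>R axis i 1)) = (*) (f' (axis i 1))"
    using linear_scale[OF has_derivative_linear[OF assms]] by (auto simp: mult.commute)
  ultimately show ?thesis
    unfolding partial_deriv_def by (intro DERIV_imp_deriv) (simp add: has_field_derivative_def)
qed

lemma partial_deriv_component_eq:
  assumes "(F has_derivative F') (at x)"
  shows "partial_deriv i (\<lambda>y. F y $ j) x = F' (axis i 1) $ j"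
  by (rule partial_deriv_eq[OF bounded_linear.has_derivative[OF bounded_linear_vec_nth assms]])

lemma divergence_eq:
  assumes "(F has_derivative F') (at x)"
  shows "divergence F x = (\<Sum>i\<in>UNIV. F' (axis i 1) $ i)"
  unfolding divergence_def by (simp add: partial_deriv_component_eq[OF assms])

lemma divergence_add:
  assumes "F differentiable (at x)" and "G differentiable (at x)"
  shows "divergence (\<lambda>y. F y + G y) x = divergence F x + divergence G x"
proof -
  obtain F' G' where "(F has_derivative F') (at x)" "(G has_derivative G') (at x)"
    using assms unfolding differentiable_def by blast
  then show ?thesis
    by (simp add: divergence_eq[OF has_derivative_add] divergence_eq sum.distrib)
qed

lemma divergence_scaleR_const:
  assumes "F differentiable (at x)"
  shows "divergence (\<lambda>y. c *\<^sub>R F y) x = c * divergence F x"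
proof -
  obtain F' where F': "(F has_derivative F') (at x)"
    using assms unfolding differentiable_def by blast
  show ?thesis
    by (simp add: divergence_eq[OF has_derivative_scaleR_right[OF F']] divergence_eq[OF F']
        sum_distrib_left)
qed

lemma divergence_scaleR:
  assumes "f differentiable (at x)" and "F differentiable (at x)"
  shows "divergence (\<lambda>y. f y *\<^sub>R F y) x = f x * divergence F x + F x \<bullet> gradient f x"
proof -
  obtain f' F' where f': "(f has_derivative f') (at x)" and F': "(F has_derivative F') (at x)"
    using assms unfolding differentiable_def by blast
  show ?thesis
    by (simp add: divergence_eq[OF has_derivative_scaleR[OF f' F']] divergence_eq[OF F']
        gradient_def partial_deriv_eq[OF f'] inner_vec_def sum.distrib sum_distrib_left mult.commute)
qed

lemma bounded_bilinear_cross3: "bounded_bilinear cross3"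
  using bilinear_cross bilinear_conv_bounded_bilinear by blast

text \<open>After the Leibniz rule both sides are polynomials in the components of
  \<open>F x\<close>, \<open>G x\<close> and in the entries of the two Jacobian matrices; they agree
  once the three coordinates are written out.\<close>

lemma divergence_cross3:
  assumes "F differentiable (at x)" and "G differentiable (at x)"
  shows "divergence (\<lambda>y. cross3 (F y) (G y)) x = G x \<bullet> curl F x - F x \<bullet> curl G x"
proof -
  obtain F' G' where F': "(F has_derivative F') (at x)" and G': "(G has_derivative G') (at x)"
    using assms unfolding differentiable_def by blast
  show ?thesis
    unfolding divergence_eq[OF bounded_bilinear.FDERIV[OF bounded_bilinear_cross3 F' G']]
      curl_def partial_deriv_component_eq[OF F'] partial_deriv_component_eq[OF G']
    by (simp add: sum_3 inner_vec_def cross3_def algebra_simps)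
qed

section \<open>Increments of integrals depending on time\<close>

text \<open>The closure of a bounded set is compact, where continuous functions are integrable;
  integrability then passes to the measurable subset \<open>S\<close>.\<close>

lemma set_integrable_continuous_on_closure:
  fixes f :: "'a::euclidean_space \<Rightarrow> 'b::euclidean_space"
  assumes "bounded S" and "S \<in> sets borel" and "continuous_on (closure S) f"
  shows "set_integrable lborel S f"
proof (rule set_integrable_subset)
  show "set_integrable lborel (closure S) f"
    unfolding set_integrable_def using assms by (intro borel_integrable_compact) auto
qed (use assms closure_subset in auto)

text \<open>Leibniz' rule in integrated form: Fubini's theorem replaces differentiation under the
  integral sign.\<close>

lemma set_integral_increment:
  fixes e :: "'a::euclidean_space \<Rightarrow> real \<Rightarrow> real"
  assumes S: "bounded S" "S \<in> sets borel" and "a \<le> b"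
    and e: "\<And>t. t \<in> {a..b} \<Longrightarrow> continuous_on (closure S) (\<lambda>x. e x t)"
    and e': "continuous_on (closure S \<times> {a..b}) e'"
    and deriv: "\<And>x t. x \<in> S \<Longrightarrow> t \<in> {a..b} \<Longrightarrow>
      ((\<lambda>s. e x s) has_vector_derivative e' (x, t)) (at t within {a..b})"
  shows "(LINT x:S|lborel. e x b) - (LINT x:S|lborel. e x a)
      = (LINT s:{a..b}|lborel. LINT x:S|lborel. e' (x, s))"
proof -
  \<comment> \<open>The closure of \<open>S \<times> {a..b}\<close> is
    \<open>closure S \<times> {a..b}\<close>, so continuity up to the boundary yields the joint
    integrability that Fubini requires.\<close>
  have "set_integrable lborel (S \<times> {a..b}) e'"
    using S e' by (intro set_integrable_continuous_on_closure)
      (auto simp: bounded_Times closure_Times intro!: borel_Times)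
  moreover have "(\<lambda>p. indicator (S \<times> {a..b}) p *\<^sub>R e' p)
      = (\<lambda>(x, s). indicator S x *\<^sub>R (indicator {a..b} s *\<^sub>R e' (x, s)))"
    by (auto simp: indicator_def fun_eq_iff)
  ultimately have "integrable (lborel \<Otimes>\<^sub>M lborel)
      (\<lambda>(x, s). indicator S x *\<^sub>R (indicator {a..b} s *\<^sub>R e' (x, s)))"
    unfolding set_integrable_def lborel_prod by simp
  note fubini = lborel_pair.Fubini_integral[OF this]
  have "(LINT x:S|lborel. e x b) - (LINT x:S|lborel. e x a) = (LINT x:S|lborel. e x b - e x a)"
    using assms by (intro set_integral_diff(2)[symmetric] set_integrable_continuous_on_closure) auto
  also have "\<dots> = (LINT x:S|lborel. LINT s:{a..b}|lborel. e' (x, s))"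
  proof (rule set_lebesgue_integral_cong)
    show "\<forall>x. x \<in> S \<longrightarrow> e x b - e x a = (LINT s:{a..b}|lborel. e' (x, s))"
    proof (intro allI impI)
      fix x assume x: "x \<in> S"
      have "continuous_on {a..b} (\<lambda>s. e' (x, s))"
        by (rule continuous_on_compose2[OF e'])
           (use x closure_subset in \<open>auto intro!: continuous_intros\<close>)
      then show "e x b - e x a = (LINT s:{a..b}|lborel. e' (x, s))"
        unfolding set_lebesgue_integral_def using \<open>a \<le> b\<close> deriv[OF x]
        by (intro integral_FTC_atLeastAtMost[symmetric]) auto
    qed
  qed (use S in auto)
  \<comment> \<open>Each outer indicator is constant for the inner integral and moves inside it;
    both iterated integrals then have the integrand to which Fubini applies.\<close>
  also have "\<dots> = (LINT s:{a..b}|lborel. LINT x:S|lborel. e' (x, s))"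
    using fubini
    unfolding set_lebesgue_integral_def real_scaleR_def integral_mult_right_zero[symmetric]
    by (simp add: mult.left_commute del: integral_mult_right_zero)
  finally show ?thesis .
qed
text \<open>Differentiates \<open>f \<bullet> f\<close> by the product rule. On the reals the norm
  squared is the ordinary square, so scalar and vector fields are treated alike.\<close>

lemma has_vector_derivative_half_norm_power2:
  fixes f :: "real \<Rightarrow> 'a::real_inner"
  assumes "(f has_vector_derivative f') (at t within S)"
  shows "((\<lambda>s. (norm (f s))\<^sup>2 / 2) has_vector_derivative f t \<bullet> f') (at t within S)"
proof -
  have "((\<lambda>s. f s \<bullet> f s) has_vector_derivative f t \<bullet> f' + f' \<bullet> f t) (at t within S)"
    by (rule bounded_bilinear.has_vector_derivative[OF bounded_bilinear_inner assms assms])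
  from has_vector_derivative_scaleR[OF DERIV_const this, of "1/2"]
  show ?thesis
    by (simp add: power2_norm_eq_inner inner_commute)
qed

text \<open>For finite \<open>\<tau>\<close> this is the usual reciprocal, and for
  \<open>\<tau> = \<infinity>\<close> it is \<open>0\<close>, which encodes the absence of
  relaxation.\<close>

lemma real_of_ereal_inverse_nonneg:
  assumes "\<tau> > (0::ereal)"
  shows "0 \<le> real_of_ereal (1 / \<tau>)"
  using assms by (cases \<tau>) (auto simp: one_ereal_def)

section \<open>Energy balance\<close>

text \<open>The fields are smooth up to the boundary and the end times, so time derivatives are
  taken within \<open>{0..tf}\<close> and are one-sided at its ends. The equations themselves are
  imposed at points of the open set \<open>\<Omega>\<close>.\<close>

theorem mainTheorem4:
  fixes \<Omega> :: "(real^3) set" and n :: "real^3 \<Rightarrow> real^3"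
    and tf c0 ch :: real and \<tau> :: ereal
    and T \<phi> :: "real^3 \<Rightarrow> real \<Rightarrow> real" and J \<psi> :: "real^3 \<Rightarrow> real \<Rightarrow> real^3"
  assumes "open \<Omega>" and "connected \<Omega>" and "\<Omega> \<noteq> {}" and "bounded \<Omega>"
    and "outward_unit_normal_field \<Omega> n" and "divergence_theorem_holds \<Omega> n"
    and "tf > 0" and "\<tau> > 0"
    and "smooth_on (closure \<Omega> \<times> {0..tf}) (\<lambda>(x, t). T x t)"
    and "smooth_on (closure \<Omega> \<times> {0..tf}) (\<lambda>(x, t). J x t)"
    and "smooth_on (closure \<Omega> \<times> {0..tf}) (\<lambda>(x, t). \<psi> x t)"
    and "smooth_on (closure \<Omega> \<times> {0..tf}) (\<lambda>(x, t). \<phi> x t)"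
    and "\<forall>x\<in>\<Omega>. \<forall>t\<in>{0..tf}.
      vector_derivative (\<lambda>s. T x s) (at t within {0..tf})
        + c0 * divergence (\<lambda>y. J y t) x = 0"
    and "\<forall>x\<in>\<Omega>. \<forall>t\<in>{0..tf}.
      vector_derivative (\<lambda>s. J x s) (at t within {0..tf})
        + c0 *\<^sub>R gradient (\<lambda>y. T y t) x + ch *\<^sub>R curl (\<lambda>y. \<psi> y t) x
      = - (real_of_ereal (1 / \<tau>) *\<^sub>R J x t)"
    and "\<forall>x\<in>\<Omega>. \<forall>t\<in>{0..tf}.
      vector_derivative (\<lambda>s. \<psi> x s) (at t within {0..tf})
        - ch *\<^sub>R curl (\<lambda>y. J y t) x + ch *\<^sub>R gradient (\<lambda>y. \<phi> y t) x = 0"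
    and "\<forall>x\<in>\<Omega>. \<forall>t\<in>{0..tf}.
      vector_derivative (\<lambda>s. \<phi> x s) (at t within {0..tf})
        + ch * divergence (\<lambda>y. \<psi> y t) x = 0"
    and "\<forall>t\<in>{0..tf}.
      flux \<Omega> n (\<lambda>x. (c0 * T x t) *\<^sub>R J x t + ch *\<^sub>R cross3 (\<psi> x t) (J x t)
                      + (ch * \<phi> x t) *\<^sub>R \<psi> x t) = 0"
  shows
    "(\<forall>t\<in>{0..tf}.
        energy \<Omega> T J \<psi> \<phi> t - energy \<Omega> T J \<psi> \<phi> 0
          = - real_of_ereal (1 / \<tau>) * (LINT s:{0..t}|lborel. LINT x:\<Omega>|lborel. (norm (J x s))\<^sup>2)
        \<and> - real_of_ereal (1 / \<tau>) * (LINT s:{0..t}|lborel. LINT x:\<Omega>|lborel. (norm (J x s))\<^sup>2) \<le> 0)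
     \<and> (\<tau> < \<infinity> \<longrightarrow> antimono_on {0..tf} (energy \<Omega> T J \<psi> \<phi>))
     \<and> (\<tau> = \<infinity> \<longrightarrow> (\<forall>t\<in>{0..tf}. energy \<Omega> T J \<psi> \<phi> t = energy \<Omega> T J \<psi> \<phi> 0))
     \<and> in_Linf_L2 tf \<Omega> (\<lambda>x t. (T x t, J x t, \<psi> x t, \<phi> x t))
     \<and> Linf_L2_norm tf \<Omega> (\<lambda>x t. (T x t, J x t, \<psi> x t, \<phi> x t))
         \<le> ereal (sqrt (2 * energy \<Omega> T J \<psi> \<phi> 0))"
proof -

  \<comment> \<open>Regularity of the fields up to the boundary\<close>
  note smT = assms(9) and smJ = assms(10) and sm\<psi> = assms(11) and sm\<phi> = assms(12)
  define \<kappa> where "\<kappa> = real_of_ereal (1 / \<tau>)"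
  have \<kappa>: "0 \<le> \<kappa>"
    unfolding \<kappa>_def using \<open>\<tau> > 0\<close> by (rule real_of_ereal_inverse_nonneg)
  \<comment> \<open>Regularity is given on \<open>closure \<Omega>\<close>, while spatial
    differentiability will be drawn from its interior; the open set \<open>\<Omega>\<close> lies
    there.\<close>
  have \<Omega>: "\<Omega> \<in> sets borel" "\<Omega> \<subseteq> closure \<Omega>" "\<Omega> \<subseteq> interior (closure \<Omega>)"
    using \<open>open \<Omega>\<close> by (simp_all add: closure_subset interior_maximal)

  obtain T' where T': "continuous_on (closure \<Omega> \<times> {0..tf}) T'"
    "\<And>x t. x \<in> closure \<Omega> \<Longrightarrow> t \<in> {0..tf} \<Longrightarrow>
      ((\<lambda>s. T x s) has_vector_derivative T' (x, t)) (at t within {0..tf})"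
    using smooth_on_time_derivative[OF smT] by blast
  obtain J' where J': "continuous_on (closure \<Omega> \<times> {0..tf}) J'"
    "\<And>x t. x \<in> closure \<Omega> \<Longrightarrow> t \<in> {0..tf} \<Longrightarrow>
      ((\<lambda>s. J x s) has_vector_derivative J' (x, t)) (at t within {0..tf})"
    using smooth_on_time_derivative[OF smJ] by blast
  obtain \<psi>' where \<psi>': "continuous_on (closure \<Omega> \<times> {0..tf}) \<psi>'"
    "\<And>x t. x \<in> closure \<Omega> \<Longrightarrow> t \<in> {0..tf} \<Longrightarrow>
      ((\<lambda>s. \<psi> x s) has_vector_derivative \<psi>' (x, t)) (at t within {0..tf})"
    using smooth_on_time_derivative[OF sm\<psi>] by blast
  obtain \<phi>' where \<phi>': "continuous_on (closure \<Omega> \<times> {0..tf}) \<phi>'"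
    "\<And>x t. x \<in> closure \<Omega> \<Longrightarrow> t \<in> {0..tf} \<Longrightarrow>
      ((\<lambda>s. \<phi> x s) has_vector_derivative \<phi>' (x, t)) (at t within {0..tf})"
    using smooth_on_time_derivative[OF sm\<phi>] by blast

  note cont = smT[THEN smooth_on_imp_continuous_on] smJ[THEN smooth_on_imp_continuous_on]
    sm\<psi>[THEN smooth_on_imp_continuous_on] sm\<phi>[THEN smooth_on_imp_continuous_on]
  have slice: "continuous_on (closure \<Omega>) (\<lambda>x. f x t)"
    if "continuous_on (closure \<Omega> \<times> {0..tf}) (\<lambda>(x, t). f x t)" "t \<in> {0..tf}"
    for f :: "real^3 \<Rightarrow> real \<Rightarrow> 'c::topological_space" and t
  proof -
    have "continuous_on (closure \<Omega>) (\<lambda>x. (\<lambda>(x, t). f x t) (x, t))"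
      by (rule continuous_on_compose2[OF that(1)]) (use that(2) in \<open>auto intro!: continuous_intros\<close>)
    then show ?thesis by simp
  qed
  note contT = cont(1)[THEN slice] and contJ = cont(2)[THEN slice]
    and cont\<psi> = cont(3)[THEN slice] and cont\<phi> = cont(4)[THEN slice]

  \<comment> \<open>The energy density and its time derivative\<close>
  define e where "e x t = 1/2 * ((T x t)\<^sup>2 + (norm (J x t))\<^sup>2 + (norm (\<psi> x t))\<^sup>2 + (\<phi> x t)\<^sup>2)" for x t
  define e' where "e' = (\<lambda>(x, t). T x t * T' (x, t) + J x t \<bullet> J' (x, t)
      + \<psi> x t \<bullet> \<psi>' (x, t) + \<phi> x t * \<phi>' (x, t))"
  have E: "energy \<Omega> T J \<psi> \<phi> t = (LINT x:\<Omega>|lborel. e x t)" for t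
    unfolding energy_def e_def ..
  have cont_e: "continuous_on (closure \<Omega>) (\<lambda>x. e x t)" if "t \<in> {0..tf}" for t
    unfolding e_def using that
    by (intro continuous_intros contT contJ cont\<psi> cont\<phi>)
  have cont_e': "continuous_on (closure \<Omega> \<times> {0..tf}) e'"
    unfolding e'_def using cont T'(1) J'(1) \<psi>'(1) \<phi>'(1)
    by (auto simp: case_prod_beta' intro!: continuous_intros)
  have deriv_e: "((\<lambda>s. e x s) has_vector_derivative e' (x, t)) (at t within {0..tf})"
    if "x \<in> \<Omega>" "t \<in> {0..tf}" for x t
  proof -
    \<comment> \<open>Writing the scalar squares as squared norms lets one differentiation rule
      cover all four terms.\<close>
    have "(\<lambda>s. e x s) = (\<lambda>s. (norm (T x s))\<^sup>2 / 2 + (norm (J x s))\<^sup>2 / 2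
        + (norm (\<psi> x s))\<^sup>2 / 2 + (norm (\<phi> x s))\<^sup>2 / 2)"
      by (auto simp: e_def field_simps)
    moreover have "e' (x, t) = T x t \<bullet> T' (x, t) + J x t \<bullet> J' (x, t)
        + \<psi> x t \<bullet> \<psi>' (x, t) + \<phi> x t \<bullet> \<phi>' (x, t)"
      by (simp add: e'_def)
    ultimately show ?thesis
      by (simp only:)
        (intro has_vector_derivative_add has_vector_derivative_half_norm_power2
          T'(2) J'(2) \<psi>'(2) \<phi>'(2); use that \<Omega>(2) in auto)
  qed

  \<comment> \<open>The energy flux and its vanishing total divergence\<close>
  define F where "F t = (\<lambda>x. (c0 * T x t) *\<^sub>R J x t + ch *\<^sub>R cross3 (\<psi> x t) (J x t)
                      + (ch * \<phi> x t) *\<^sub>R \<psi> x t)" for t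
  \<comment> \<open>The constants are split off so that each term is a constant multiple of a
    product of two fields, matching the product rules.\<close>
  have F_eq: "F t = (\<lambda>x. c0 *\<^sub>R (T x t *\<^sub>R J x t) + ch *\<^sub>R cross3 (\<psi> x t) (J x t)
                      + ch *\<^sub>R (\<phi> x t *\<^sub>R \<psi> x t))" for t
    by (simp add: F_def)
  note C1 = smooth_on_slice[OF smT] smooth_on_slice[OF smJ] smooth_on_slice[OF sm\<psi>]
    smooth_on_slice[OF sm\<phi>]
  note C1_intros = Ck_on_1_add Ck_on_1_bounded_bilinear[OF bounded_bilinear_scaleR]
    Ck_on_1_bounded_bilinear[OF bounded_bilinear_cross3] Ck_on_1_const C1
  have F_C1: "Ck_on 1 (closure \<Omega>) (F t)" if "t \<in> {0..tf}" for t
    unfolding F_eq by (intro C1_intros that)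
  have "flux \<Omega> n (F t) = 0" if "t \<in> {0..tf}" for t
    using assms(17) that by (simp add: F_def)
  then have div_F: "(LINT x:\<Omega>|lborel. divergence (F t) x) = 0" if "t \<in> {0..tf}" for t
    using \<open>divergence_theorem_holds \<Omega> n\<close> F_C1[OF that] that
    by (simp add: divergence_theorem_holds_def)

  \<comment> \<open>The local energy balance\<close>
  have local_balance: "e' (x, t) = - divergence (F t) x - \<kappa> * (norm (J x t))\<^sup>2"
    if x: "x \<in> \<Omega>" and t: "t \<in> {0..tf}" for x t
  proof -
    have x': "x \<in> closure \<Omega>" "x \<in> interior (closure \<Omega>)"
      using x \<Omega> by auto
    \<comment> \<open>As \<open>0 < tf\<close>, derivatives within \<open>{0..tf}\<close> are
      unique, so \<open>vector_derivative\<close> in the equations equals the continuous derivatives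
      \<open>T'\<close>, \<open>J'\<close>, \<open>\<psi>'\<close>, \<open>\<phi>'\<close>.\<close>
    note vd = vector_derivative_within_closed_interval[OF \<open>0 < tf\<close> t]
    have eqs: "T' (x, t) = - (c0 * divergence (\<lambda>y. J y t) x)"
      "J' (x, t) = - (\<kappa> *\<^sub>R J x t) - c0 *\<^sub>R gradient (\<lambda>y. T y t) x - ch *\<^sub>R curl (\<lambda>y. \<psi> y t) x"
      "\<psi>' (x, t) = ch *\<^sub>R curl (\<lambda>y. J y t) x - ch *\<^sub>R gradient (\<lambda>y. \<phi> y t) x"
      "\<phi>' (x, t) = - (ch * divergence (\<lambda>y. \<psi> y t) x)"
      using assms(13-16)[rule_format, OF x t]
      unfolding vd[OF T'(2)[OF x'(1) t]] vd[OF J'(2)[OF x'(1) t]]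
        vd[OF \<psi>'(2)[OF x'(1) t]] vd[OF \<phi>'(2)[OF x'(1) t]] \<kappa>_def[symmetric]
      by (auto simp: algebra_simps eq_neg_iff_add_eq_0)
    note diff = Ck_on_1_differentiable[OF _ x'(2)]
    have "divergence (F t) x = c0 * (T x t * divergence (\<lambda>y. J y t) x
          + J x t \<bullet> gradient (\<lambda>y. T y t) x)
        + ch * (J x t \<bullet> curl (\<lambda>y. \<psi> y t) x - \<psi> x t \<bullet> curl (\<lambda>y. J y t) x)
        + ch * (\<phi> x t * divergence (\<lambda>y. \<psi> y t) x + \<psi> x t \<bullet> gradient (\<lambda>y. \<phi> y t) x)"
      unfolding F_eq using t
      by (simp only: divergence_add divergence_scaleR_const divergence_scaleR divergence_cross3
          diff C1_intros)
    \<comment> \<open>With the equations inserted in \<open>e'\<close>, every gradient, curl and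
      divergence term is the negative of one in \<open>divergence (F t) x\<close>; only the
      relaxation term remains.\<close>
    then show ?thesis
      by (simp add: e'_def eqs inner_diff_right power2_norm_eq_inner algebra_simps)
  qed

  \<comment> \<open>The energy balance between two times\<close>
  have balance: "energy \<Omega> T J \<psi> \<phi> b - energy \<Omega> T J \<psi> \<phi> a
      = - \<kappa> * (LINT s:{a..b}|lborel. LINT x:\<Omega>|lborel. (norm (J x s))\<^sup>2)"
    if ab: "0 \<le> a" "a \<le> b" "b \<le> tf" for a b
  proof -
    \<comment> \<open>The initial time is kept general: \<open>a = 0\<close> gives the stated
      identity, arbitrary \<open>a \<le> b\<close> give monotonicity.\<close>
    have sub: "{a..b} \<subseteq> {0..tf}" using ab by auto
    have "energy \<Omega> T J \<psi> \<phi> b - energy \<Omega> T J \<psi> \<phi> a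
        = (LINT s:{a..b}|lborel. LINT x:\<Omega>|lborel. e' (x, s))"
      unfolding E
    proof (rule set_integral_increment)
      show "((\<lambda>s. e x s) has_vector_derivative e' (x, t)) (at t within {a..b})"
        if "x \<in> \<Omega>" "t \<in> {a..b}" for x t
        using has_vector_derivative_within_subset[OF deriv_e sub] that sub by blast
      show "continuous_on (closure \<Omega> \<times> {a..b}) e'"
        using cont_e' by (rule continuous_on_subset) (use sub in auto)
    qed (use \<open>bounded \<Omega>\<close> \<Omega>(1) ab cont_e in auto)
    also have "\<dots> = (LINT s:{a..b}|lborel. - \<kappa> * (LINT x:\<Omega>|lborel. (norm (J x s))\<^sup>2))"
    proof (rule set_lebesgue_integral_cong, simp, intro allI impI)
      fix s assume "s \<in> {a..b}"
      then have s: "s \<in> {0..tf}" using sub by auto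
      have int: "set_integrable lborel \<Omega> (\<lambda>x. (norm (J x s))\<^sup>2)"
        "set_integrable lborel \<Omega> (\<lambda>x. e' (x, s))"
        using \<open>bounded \<Omega>\<close> \<Omega>(1) s cont_e'
        by (intro set_integrable_continuous_on_closure continuous_intros contJ slice; simp)+
      \<comment> \<open>The two summands are integrable by continuity, and their sum is pointwise
        \<open>- divergence (F s) x\<close>, whose integral vanishes.\<close>
      have "(LINT x:\<Omega>|lborel. e' (x, s)) + \<kappa> * (LINT x:\<Omega>|lborel. (norm (J x s))\<^sup>2)
          = (LINT x:\<Omega>|lborel. e' (x, s) + \<kappa> * (norm (J x s))\<^sup>2)"
        using int by (simp add: set_integral_add)
      also have "\<dots> = (LINT x:\<Omega>|lborel. - divergence (F s) x)"
        using \<Omega>(1) s by (intro set_lebesgue_integral_cong) (auto simp: local_balance)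
      also have "\<dots> = 0"
        using div_F[OF s] by (simp add: set_lebesgue_integral_def)
      finally show "(LINT x:\<Omega>|lborel. e' (x, s)) = - \<kappa> * (LINT x:\<Omega>|lborel. (norm (J x s))\<^sup>2)"
        by simp
    qed
    finally show ?thesis by (simp only: set_integral_mult_right)
  qed
  have J_nonneg: "0 \<le> (LINT s:{a..b}|lborel. LINT x:\<Omega>|lborel. (norm (J x s))\<^sup>2)" for a b
    by (simp add: set_lebesgue_integral_def)

  \<comment> \<open>Monotonicity of the energy\<close>
  have anti: "antimono_on {0..tf} (energy \<Omega> T J \<psi> \<phi>)"
  proof (rule monotone_onI)
    fix a b assume "a \<in> {0..tf}" "b \<in> {0..tf}" "a \<le> b"
    then have "energy \<Omega> T J \<psi> \<phi> b - energy \<Omega> T J \<psi> \<phi> a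
        = - (\<kappa> * (LINT s:{a..b}|lborel. LINT x:\<Omega>|lborel. (norm (J x s))\<^sup>2))"
      by (simp add: balance)
    also have "\<dots> \<le> 0"
      using J_nonneg \<kappa> by simp
    finally show "energy \<Omega> T J \<psi> \<phi> b \<le> energy \<Omega> T J \<psi> \<phi> a"
      by simp
  qed

  \<comment> \<open>The uniform bound\<close>
  let ?u = "\<lambda>x t. (T x t, J x t, \<psi> x t, \<phi> x t)"
  have cont_u: "continuous_on (closure \<Omega> \<times> {0..tf}) (\<lambda>(x, t). ?u x t)"
    using cont by (auto simp: case_prod_beta' intro!: continuous_intros)
  \<comment> \<open>The norm on nested pairs is Euclidean in the components, so no equivalence
    constant enters.\<close>
  have norm_u: "(norm (?u x t))\<^sup>2 = 2 * e x t" for x t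
    by (simp add: norm_Pair e_def)
  have L2_u: "L2_norm \<Omega> (\<lambda>x. ?u x t) = ereal (sqrt (2 * energy \<Omega> T J \<psi> \<phi> t))"
    if "t \<in> {0..tf}" for t
  proof -
    \<comment> \<open>The first fact supplies measurability, the second integrability of the squared
      norm; together they exclude the default value \<open>\<infinity>\<close> of
      \<open>L2_norm\<close>.\<close>
    have "set_integrable lborel \<Omega> (\<lambda>x. ?u x t)" "set_integrable lborel \<Omega> (\<lambda>x. 2 * e x t)"
      using \<open>bounded \<Omega>\<close> \<Omega>(1) that
      by (intro set_integrable_continuous_on_closure continuous_intros cont_e slice[OF cont_u]; simp)+
    then have "set_borel_measurable lborel \<Omega> (\<lambda>x. ?u x t)"
      "set_integrable lborel \<Omega> (\<lambda>x. (norm (?u x t))\<^sup>2)"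
      unfolding norm_u by (auto simp: set_integrable_def set_borel_measurable_def)
    then show ?thesis
      unfolding L2_norm_def E norm_u by simp
  qed
  \<comment> \<open>The bound on the essential supremum requires measurability in time. It comes
    from monotonicity: the negated energy is non-decreasing.\<close>
  have "(\<lambda>t. - energy \<Omega> T J \<psi> \<phi> t) \<in> borel_measurable (restrict_space borel {0<..<tf})"
    using anti by (intro borel_measurable_mono_on_fnc) (auto simp: monotone_on_def)
  then have "(\<lambda>t. - (- energy \<Omega> T J \<psi> \<phi> t)) \<in> borel_measurable (restrict_space borel {0<..<tf})"
    by (rule borel_measurable_uminus)
  then have "(\<lambda>t. ereal (sqrt (2 * energy \<Omega> T J \<psi> \<phi> t)))
      \<in> borel_measurable (restrict_space lborel {0<..<tf})"
    by (simp cong: measurable_cong_sets restrict_space_sets_cong)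
  moreover have "L2_norm \<Omega> (\<lambda>x. ?u x t) = ereal (sqrt (2 * energy \<Omega> T J \<psi> \<phi> t))"
    if "t \<in> space (restrict_space lborel {0<..<tf})" for t
    using that by (intro L2_u) (auto simp: space_restrict_space)
  ultimately have meas: "(\<lambda>t. L2_norm \<Omega> (\<lambda>x. ?u x t))
      \<in> borel_measurable (restrict_space lborel {0<..<tf})"
    by (subst measurable_cong)
  have bound: "Linf_L2_norm tf \<Omega> ?u \<le> ereal (sqrt (2 * energy \<Omega> T J \<psi> \<phi> 0))"
    unfolding Linf_L2_norm_def
  proof (rule esssup_I[OF meas AE_I2])
    fix t assume "t \<in> space (restrict_space lborel {0<..<tf})"
    then have "t \<in> {0..tf}" "0 \<le> t" by (auto simp: space_restrict_space)
    then show "L2_norm \<Omega> (\<lambda>x. ?u x t) \<le> ereal (sqrt (2 * energy \<Omega> T J \<psi> \<phi> 0))"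
      using monotone_onD[OF anti, of 0 t] by (simp add: L2_u)
  qed
  have "set_borel_measurable lborel (\<Omega> \<times> {0<..<tf}) (\<lambda>(x, t). ?u x t)"
  proof -
    \<comment> \<open>Joint continuity on an open set gives the joint measurability demanded by
      \<open>in_Linf_L2\<close>.\<close>
    have "continuous_on (\<Omega> \<times> {0<..<tf}) (\<lambda>(x, t). ?u x t)"
      using cont_u by (rule continuous_on_subset) (use \<Omega>(2) in auto)
    then have "set_borel_measurable borel (\<Omega> \<times> {0<..<tf}) (\<lambda>(x, t). ?u x t)"
      by (rule set_measurable_continuous_on[rotated])
        (intro borel_open open_Times open_greaterThanLessThan \<open>open \<Omega>\<close>)
    then show ?thesis
      unfolding set_borel_measurable_def measurable_lborel2 .
  qed
  moreover have "Linf_L2_norm tf \<Omega> ?u < \<infinity>"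
    using bound by (rule le_less_trans) simp
  ultimately have "in_Linf_L2 tf \<Omega> ?u"
    unfolding in_Linf_L2_def by (rule conjI)
  moreover have "energy \<Omega> T J \<psi> \<phi> t = energy \<Omega> T J \<psi> \<phi> 0" if "\<tau> = \<infinity>" "t \<in> {0..tf}" for t
    using balance[of 0 t] that by (simp add: \<kappa>_def)
  moreover have "energy \<Omega> T J \<psi> \<phi> t - energy \<Omega> T J \<psi> \<phi> 0
        = - \<kappa> * (LINT s:{0..t}|lborel. LINT x:\<Omega>|lborel. (norm (J x s))\<^sup>2)"
      "- \<kappa> * (LINT s:{0..t}|lborel. LINT x:\<Omega>|lborel. (norm (J x s))\<^sup>2) \<le> 0"
    if "t \<in> {0..tf}" for t
    using that balance[of 0 t] mult_nonneg_nonneg[OF \<kappa> J_nonneg[of 0 t]] by simp_all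
  ultimately show ?thesis
    using anti bound unfolding \<kappa>_def[symmetric] by (intro conjI ballI impI)
qed

end
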